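(* For all integers $a,b\geq 1$ and all $n\geq 0$, $$\sigma_a\bigl(\mathfrak{F}^{(b,a)}_n\bigr)=\mathfrak{F}^{(a,b)}_{n+1},$$ and consequently, for the infinite words, $\sigma_a\bigl(\mathfrak{F}^{(b,a)}\bigr)=\mathfrak{F}^{(a,b)}$.
   Context: Words are over the alphabet $\{0,1\}$; juxtaposition is concatenation and $w^k$ is the $k$-fold concatenation. For integers $a,b\geq 1$ the finite biperiodic Fibonacci words are defined by $\mathfrak{F}^{(a,b)}_0=1$, $\mathfrak{F}^{(a,b)}_1=0$, and for $n\geq 2$: $\mathfrak{F}^{(a,b)}_n=(\mathfrak{F}^{(a,b)}_{n-1})^a\,\mathfrak{F}^{(a,b)}_{n-2}$ if $n$ is even, $\mathfrak{F}^{(a,b)}_n=(\mathfrak{F}^{(a,b)}_{n-1})^b\,\mathfrak{F}^{(a,b)}_{n-2}$ if $n$ is odd. $\mathfrak{F}^{(b,a)}_n$ is obtained by exchanging the roles of $a$ and $b$. For $n\geq 1$, $\mathfrak{F}^{(a,b)}_n$ is a prefix of $\mathfrak{F}^{(a,b)}_{n+1}$, and the infinite word $\mathfrak{F}^{(a,b)}=\lim_{n\to\infty}\mathfrak{F}^{(a,b)}_n$ is the biperiodic Fibonacci word (the unique infinite word having every $\mathfrak{F}^{(a,b)}_n$, $n\ge 1$, as a prefix). For an integer $d\geq 1$, $\sigma_d$ is the monoid morphism on finite words with $\sigma_d(0)=0^d1$, $\sigma_d(1)=0$, extended to infinite words letter by letter. *)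

theory Defs
  imports "HOL-Library.Stream"
begin

datatype letter = L0 | L1

abbreviation word_power :: "'a list \<Rightarrow> nat \<Rightarrow> 'a list" where
  "word_power w k \<equiv> concat (replicate k w)"

fun bifib :: "nat \<Rightarrow> nat \<Rightarrow> nat \<Rightarrow> letter list" where
  "bifib a b 0 = [L1]"
| "bifib a b (Suc 0) = [L0]"
| "bifib a b (Suc (Suc n)) =
     (if even (Suc (Suc n))
      then word_power (bifib a b (Suc n)) a @ bifib a b n
      else word_power (bifib a b (Suc n)) b @ bifib a b n)"

definition is_prefix_of_stream :: "'a list \<Rightarrow> 'a stream \<Rightarrow> bool" where
  "is_prefix_of_stream w s \<longleftrightarrow> (\<exists>t. s = w @- t)"

text \<open>The index starts at 1: the word with index 0 is \<open>1\<close>, whereas all the others start with \<open>0\<close>.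
  For \<open>a, b \<ge> 1\<close> the description is meaningful by \<open>bifib_stream_ex1\<close> below.\<close>

definition bifib_stream :: "nat \<Rightarrow> nat \<Rightarrow> letter stream" where
  "bifib_stream a b = (THE s. \<forall>n\<ge>1. is_prefix_of_stream (bifib a b n) s)"

fun sigma_letter :: "nat \<Rightarrow> letter \<Rightarrow> letter list" where
  "sigma_letter d L0 = replicate d L0 @ [L1]"
| "sigma_letter d L1 = [L0]"

definition sigma :: "nat \<Rightarrow> letter list \<Rightarrow> letter list" where
  "sigma d w = concat (map (sigma_letter d) w)"

text \<open>No image of a letter is empty, so \<^const>\<open>flat\<close> is the infinite concatenation of the images
  (on a stream containing empty lists it would be underspecified).\<close>

definition sigma_stream :: "nat \<Rightarrow> letter stream \<Rightarrow> letter stream" where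
  "sigma_stream d s = flat (smap (sigma_letter d) s)"

lemma sigma_append: "sigma d (u @ v) = sigma d u @ sigma d v"
  by (simp add: sigma_def)

lemma sigma_letter_nonempty: "sigma_letter d x \<noteq> []"
  by (cases x) simp_all

lemma bifib_prefix_Suc:
  assumes "a \<ge> 1" "b \<ge> 1" "n \<ge> 1"
  shows "\<exists>v. bifib a b (Suc n) = bifib a b n @ v"
proof -
  obtain m where m: "n = Suc m" using assms by (cases n) auto
  obtain a' b' where "a = Suc a'" "b = Suc b'" using assms by (cases a; cases b) auto
  then show ?thesis unfolding m by auto
qed

lemma bifib_prefix:
  assumes "a \<ge> 1" "b \<ge> 1" "m \<ge> 1" "m \<le> n"
  shows "\<exists>v. bifib a b n = bifib a b m @ v"
  using assms(4)
proof (induction n rule: dec_induct)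
  case (step k)
  then obtain v where v: "bifib a b k = bifib a b m @ v" by blast
  obtain w where "bifib a b (Suc k) = bifib a b k @ w"
    using bifib_prefix_Suc[OF assms(1,2), of k] step assms(3) by auto
  then show ?case using v by auto
qed simp

lemma length_bifib:
  assumes "a \<ge> 1" "b \<ge> 1"
  shows "length (bifib a b n) \<ge> n \<and> length (bifib a b n) \<ge> 1"
  using assms
proof (induction a b n rule: bifib.induct)
  case (3 a b n)
  obtain a' b' where "a = Suc a'" "b = Suc b'" using 3 by (cases a; cases b) auto
  moreover have "length (bifib a b (Suc n)) \<ge> Suc n" "length (bifib a b n) \<ge> 1"
    using 3 by (cases "even n"; simp)+
  ultimately show ?case by simp
qed simp_all

lemma is_prefix_of_stream_iff_snth:
  "is_prefix_of_stream w s \<longleftrightarrow> (\<forall>i < length w. s !! i = w ! i)"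
proof
  assume r: "\<forall>i < length w. s !! i = w ! i"
  have "stake (length w) s = w" by (rule nth_equalityI) (use r in auto)
  then have "s = w @- sdrop (length w) s" by (metis stake_sdrop)
  then show "is_prefix_of_stream w s" unfolding is_prefix_of_stream_def by blast
qed (auto simp: is_prefix_of_stream_def)

lemma bifib_stream_ex1:
  assumes ab: "a \<ge> 1" "b \<ge> 1"
  shows "\<exists>!s. \<forall>n\<ge>1. is_prefix_of_stream (bifib a b n) s"
proof (rule ex_ex1I)
  define s where "s = smap (\<lambda>i. bifib a b (Suc i) ! i) nats"
  have len: "i < length (bifib a b (Suc i))" for i
    using length_bifib[OF ab, of "Suc i"] by simp
  have "s !! i = bifib a b n ! i" if "n \<ge> 1" "i < length (bifib a b n)" for n i
  proof -
    have "bifib a b n ! i = bifib a b (Suc i) ! i"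
    proof (cases "n \<le> Suc i")
      case True
      then show ?thesis using bifib_prefix[OF ab that(1) True] that(2) by (auto simp: nth_append)
    next
      case False
      then show ?thesis using bifib_prefix[OF ab, of "Suc i" n] len[of i] by (auto simp: nth_append)
    qed
    then show ?thesis by (simp add: s_def)
  qed
  then show "\<exists>s. \<forall>n\<ge>1. is_prefix_of_stream (bifib a b n) s"
    by (auto simp: is_prefix_of_stream_iff_snth)
next
  fix s t :: "letter stream"
  assume s: "\<forall>n\<ge>1. is_prefix_of_stream (bifib a b n) s"
    and t: "\<forall>n\<ge>1. is_prefix_of_stream (bifib a b n) t"
  have "s !! i = t !! i" for i
    using s[rule_format, of "Suc i"] t[rule_format, of "Suc i"] length_bifib[OF ab, of "Suc i"]
    by (simp add: is_prefix_of_stream_iff_snth del: bifib.simps)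
  then show "s = t" using smap_alt[of id s t] by (simp add: stream.map_id)
qed

end

theory Submission
  imports Defs
begin

text \<open>The morphism \<open>\<sigma>\<^sub>a\<close> sends the initial words \<open>1\<close>, \<open>0\<close> of the \<open>(b, a)\<close> recursion to \<open>0\<close>, \<open>0\<^sup>a1\<close>,
  which are the words of index 1 and 2 of the \<open>(a, b)\<close> recursion. It also carries the recursion
  itself along: the shift of the index by one changes its parity, and exchanging \<open>a\<close> and \<open>b\<close>
  compensates for this, so that both sides use the same exponent in each step.

  For the infinite words, \<open>\<sigma>\<^sub>a\<close> maps prefixes of a stream to prefixes of its image. So the image of
  the \<open>(b, a)\<close> word has all finite \<open>(a, b)\<close> words of index at least 2 as prefixes, and the word of
  index 1, being a prefix of the one of index 2, as well. By \<open>bifib_stream_ex1\<close>, this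
  characterizes the \<open>(a, b)\<close> word.\<close>

lemma sigma_word_power: "sigma d (word_power w k) = word_power (sigma d w) k"
  by (induction k) (simp_all add: sigma_append, simp add: sigma_def)

lemma sigma_bifib: "sigma a (bifib b a n) = bifib a b (Suc n)"
proof (induction n rule: induct_nat_012)
  case 1
  have "word_power [L0] k = replicate k L0" for k
    by (induction k) auto
  then show ?case by (simp add: sigma_def)
qed (simp_all add: sigma_append sigma_word_power sigma_def[of _ "[_]"])

text \<open>Since no letter has an empty image, \<^const>\<open>flat\<close> unfolds at every letter of the prefix.\<close>

lemma sigma_stream_shift: "sigma_stream d (w @- s) = sigma d w @- sigma_stream d s"
  by (induction w) (simp_all add: sigma_stream_def sigma_def sigma_letter_nonempty)

lemma is_prefix_of_sigma_stream:
  "is_prefix_of_stream w s \<Longrightarrow> is_prefix_of_stream (sigma d w) (sigma_stream d s)"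
  by (auto simp: is_prefix_of_stream_def sigma_stream_shift)

lemma is_prefix_of_stream_appendD: "is_prefix_of_stream (u @ v) s \<Longrightarrow> is_prefix_of_stream u s"
  by (auto simp: is_prefix_of_stream_def)

lemma bifib_stream_prefix:
  assumes "a \<ge> 1" "b \<ge> 1" "n \<ge> 1"
  shows "is_prefix_of_stream (bifib a b n) (bifib_stream a b)"
  using theI'[OF bifib_stream_ex1[OF assms(1,2)]] assms(3) by (simp add: bifib_stream_def)

lemma bifib_stream_eqI:
  assumes "a \<ge> 1" "b \<ge> 1" "\<And>n. n \<ge> 1 \<Longrightarrow> is_prefix_of_stream (bifib a b n) s"
  shows "s = bifib_stream a b"
  using bifib_stream_ex1[OF assms(1,2)] bifib_stream_prefix[OF assms(1,2)] assms(3) by blast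

lemma sigma_bifib_stream:
  assumes ab: "a \<ge> 1" "b \<ge> 1"
  shows "sigma_stream a (bifib_stream b a) = bifib_stream a b"
proof (rule bifib_stream_eqI[OF ab])
  fix n :: nat assume n: "n \<ge> 1"
  \<comment> \<open>Passing to index \<open>n + 1\<close> treats \<open>n = 1\<close> like the others: the \<open>(a, b)\<close> word of index 1 is
    the image of \<open>1\<close>, which is not a prefix of the \<open>(b, a)\<close> word.\<close>
  have "is_prefix_of_stream (bifib a b (Suc n)) (sigma_stream a (bifib_stream b a))"
    using is_prefix_of_sigma_stream[OF bifib_stream_prefix[OF ab(2,1) n], of a]
    by (simp only: sigma_bifib)
  then show "is_prefix_of_stream (bifib a b n) (sigma_stream a (bifib_stream b a))"
    using bifib_prefix_Suc[OF ab n] by (auto dest: is_prefix_of_stream_appendD)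
qed

theorem theorem3p4:
  fixes a b :: nat
  assumes "a \<ge> 1" and "b \<ge> 1"
  shows "(\<forall>n. sigma a (bifib b a n) = bifib a b (n + 1)) \<and>
         sigma_stream a (bifib_stream b a) = bifib_stream a b"
  using sigma_bifib sigma_bifib_stream[OF assms] by simp

end
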